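(* Let $a>0$. No composition operator on the Paley-Wiener space $B^2_a$ is Li-Yorke chaotic; that is, for every $c\in\mathbb{R}$ with $0<|c|\leq 1$ and every $d\in\mathbb{C}$, the composition operator $C_\phi f=f\circ\phi$ on $B^2_a$ with symbol $\phi(z)=cz+d$ is not Li-Yorke chaotic.
   Context: For $a>0$, the Paley-Wiener space $B^2_a$ is the Hilbert space of all entire functions of exponential type less than or equal to $a$ whose restriction to $\mathbb{R}$ belongs to $L^2(\mathbb{R})$, with inner product $\langle f,g\rangle=\int_{-\infty}^{\infty}f(t)\overline{g(t)}\,dt$ and norm $\|\cdot\|_a$. Convention: a composition operator on $B^2_a$ means an operator $C_\phi f=f\circ\phi$ with symbol $\phi(z)=cz+d$, $z\in\mathbb{C}$, where $c\in\mathbb{R}$, $0<|c|\leq1$, $d\in\mathbb{C}$; it is known that these are exactly the symbols inducing bounded composition operators on $B^2_a$. A continuous linear operator $T$ on a complex Banach space $E$ is Li-Yorke chaotic if there exists $x\in E$ such that $\liminf_{n\to\infty}\|T^nx\|=0$ and $\limsup_{n\to\infty}\|T^nx\|=\infty$. *)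

theory Defs
  imports "HOL-Analysis.Analysis"
begin

text \<open>
  "Exponential type less than or equal to \<open>a\<close>" allows an arbitrarily small loss in the
  exponent; \<open>a\<close> itself need not be an admissible exponent.
\<close>

definition exponential_type_le :: "real \<Rightarrow> (complex \<Rightarrow> complex) \<Rightarrow> bool" where
  "exponential_type_le a f \<longleftrightarrow>
     (\<forall>\<epsilon>>0. \<exists>C. \<forall>z. norm (f z) \<le> C * exp ((a + \<epsilon>) * norm z))"

text \<open>
  Elements are functions on \<open>\<complex>\<close> rather than almost-everywhere classes on \<open>\<real>\<close>: an entire
  function is determined by its restriction to \<open>\<real>\<close>, which is continuous and hence
  measurable.
\<close>

definition paley_wiener :: "real \<Rightarrow> (complex \<Rightarrow> complex) set" where
  "paley_wiener a =
     {f. f holomorphic_on UNIV \<and> exponential_type_le a f \<and>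
         integrable lborel (\<lambda>t::real. (norm (f (of_real t)))\<^sup>2)}"

definition pw_inner :: "(complex \<Rightarrow> complex) \<Rightarrow> (complex \<Rightarrow> complex) \<Rightarrow> complex" where
  "pw_inner f g = (LINT t|lborel. f (of_real t) * cnj (g (of_real t)))"

definition pw_norm :: "(complex \<Rightarrow> complex) \<Rightarrow> real" where
  "pw_norm f = sqrt (Re (pw_inner f f))"

definition composition_operator ::
  "(complex \<Rightarrow> complex) \<Rightarrow> (complex \<Rightarrow> complex) \<Rightarrow> (complex \<Rightarrow> complex)" where
  "composition_operator \<phi> f = f \<circ> \<phi>"

text \<open>
  The Banach space is given by its carrier \<open>E\<close> and its norm \<open>N\<close>. That \<open>T\<close> is a continuous
  linear operator from \<open>E\<close> to \<open>E\<close> is understood, and deliberately not a conjunct: as a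
  conjunct it would weaken negated occurrences of the predicate. The limits are taken in
  \<^typ>\<open>ereal\<close>, so that the upper limit may be infinite.
\<close>

definition li_yorke_chaotic :: "'v set \<Rightarrow> ('v \<Rightarrow> real) \<Rightarrow> ('v \<Rightarrow> 'v) \<Rightarrow> bool" where
  "li_yorke_chaotic E N T \<longleftrightarrow>
     (\<exists>x\<in>E. liminf (\<lambda>n. ereal (N ((T ^^ n) x))) = 0 \<and>
            limsup (\<lambda>n. ereal (N ((T ^^ n) x))) = \<infinity>)"

end

theory Submission
  imports Defs "HOL-Complex_Analysis.Conformal_Mappings"
begin

text \<open>
  Let \<open>E y\<close> be the integral of \<open>\<bar>f\<bar>\<^sup>2\<close> over the line \<open>Im z = y\<close>. It is finite for every \<open>y\<close>
  (Plancherel--Polya) and obeys the maximum principle \<open>E y \<le> max (E 0) (E m)\<close> for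
  \<open>0 \<le> y \<le> m\<close>. For \<open>c = 1\<close> the squared orbit norms are \<open>E (n Im d)\<close>, so a lower limit
  zero forces the orbit to be bounded by its first term. For \<open>c = - 1\<close> the orbit is periodic.
  For \<open>\<bar>c\<bar> < 1\<close> the squared norms are \<open>E y\<^sub>n / \<bar>c\<bar>\<^sup>n\<close>, where \<open>y\<^sub>n\<close> converges to the
  imaginary part of the fixed point of the symbol; they stay away from zero unless \<open>f = 0\<close>.
\<close>

section \<open>Maximum principles on unbounded regions\<close>

text \<open>The region is cut off by a disc of radius at least \<open>r\<close> containing
  \<open>z\<close>. A frontier point of the bounded piece lies outside \<open>V\<close>, where
  \<open>bd\<close> applies, or has modulus at least \<open>r\<close>, where \<open>decay\<close>
  applies. The open set \<open>V\<close> stands in for the interior of \<open>U\<close>.\<close>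

lemma maximum_modulus_decay:
  assumes U: "closed U" and V: "open V" "V \<subseteq> U" and hol: "G holomorphic_on U"
    and bd: "\<And>z. z \<in> U - V \<Longrightarrow> norm (G z) \<le> M"
    and decay: "\<And>z. z \<in> U \<Longrightarrow> r \<le> norm z \<Longrightarrow> norm (G z) \<le> M"
    and z: "z \<in> U"
  shows "norm (G z) \<le> M"
proof -
  define R where "R = max r (norm z)"
  define S where "S = U \<inter> cball 0 R"
  have S: "closed S" "bounded S" "S \<subseteq> U" "z \<in> S"
    using U z by (auto simp: S_def R_def bounded_Int)
  have int: "V \<inter> ball 0 R \<subseteq> interior S"
    by (rule interior_maximal) (use V in \<open>auto simp: S_def\<close>)
  show ?thesis
  proof (rule maximum_modulus_frontier[of G S])
    show "G holomorphic_on interior S"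
      using hol S(3) interior_subset by (blast intro: holomorphic_on_subset)
    show "continuous_on (closure S) G"
      using hol S by (auto intro: holomorphic_on_imp_continuous_on holomorphic_on_subset)
    show "norm (G w) \<le> M" if "w \<in> frontier S" for w
    proof -
      have "w \<in> S" "w \<notin> V \<inter> ball 0 R"
        using that int S(1) by (auto simp: frontier_def)
      then show ?thesis
        using bd[of w] decay[of w] by (auto simp: S_def R_def)
    qed
  qed (use S in auto)
qed

text \<open>The power trick: \<open>F w ^ n / (w + \<i>)\<close> tends to zero at infinity, and
  dividing by \<open>w + \<i>\<close>, of modulus at least 1 on \<open>U\<close>, does not increase
  the boundary bound \<open>M ^ n\<close>. The surviving factor \<open>norm (z + \<i>)\<close>
  becomes negligible on taking \<open>n\<close>-th roots.\<close>

lemma phragmen_lindelof_bounded: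
  assumes U: "closed U" "\<And>z. z \<in> U \<Longrightarrow> 0 \<le> Im z" and V: "open V" "V \<subseteq> U"
    and hol: "F holomorphic_on U"
    and C: "\<And>z. z \<in> U \<Longrightarrow> norm (F z) \<le> C"
    and bd: "\<And>z. z \<in> U - V \<Longrightarrow> norm (F z) \<le> M"
    and M: "0 < M" and z: "z \<in> U"
  shows "norm (F z) \<le> M"
proof (rule ccontr)
  assume "\<not> norm (F z) \<le> M"
  then have "1 < norm (F z) / M" using M by simp
  \<comment> \<open>If the bound failed at \<open>z\<close>, the powers of the ratio would outgrow
    the fixed number \<open>norm (z + \<i>)\<close>; this \<open>n\<close> will contradict the
    maximum principle.\<close>
  then obtain n where n: "norm (z + \<i>) < (norm (F z) / M) ^ n"
    using real_arch_pow by blast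
  have C0: "0 \<le> C" using C[OF z] norm_ge_zero order_trans by blast
  have nz: "1 \<le> norm (w + \<i>)" if "w \<in> U" for w
    using U(2)[OF that] abs_Im_le_cmod[of "w + \<i>"] by simp
  define G where "G w = F w ^ n / (w + \<i>)" for w
  have "norm (G z) \<le> M ^ n"
  proof (rule maximum_modulus_decay[where G = G, OF U(1) V])
    show "G holomorphic_on U"
      unfolding G_def using nz by (intro holomorphic_intros hol) force
    show "norm (G w) \<le> M ^ n" if "w \<in> U - V" for w
    proof -
      have "norm (F w) ^ n \<le> M ^ n * 1"
        using bd[OF that] by (simp add: power_mono)
      also have "\<dots> \<le> M ^ n * norm (w + \<i>)"
        using nz that M by (intro mult_left_mono) auto
      finally show ?thesis
        using nz[of w] that M by (simp add: G_def norm_divide norm_power divide_le_eq)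
    qed
    \<comment> \<open>Beyond this radius \<open>norm (w + \<i>)\<close> is at least
      \<open>(C / M) ^ n\<close>, which turns the global bound \<open>C ^ n\<close> into
      \<open>M ^ n\<close>.\<close>
    show "norm (G w) \<le> M ^ n" if w: "w \<in> U" "1 + (C / M) ^ n \<le> norm w" for w
    proof -
      have "norm (F w) ^ n \<le> C ^ n"
        using C[OF w(1)] by (simp add: power_mono)
      also have "\<dots> = M ^ n * (C / M) ^ n"
        using M by (simp add: power_divide)
      also have "\<dots> \<le> M ^ n * norm (w + \<i>)"
        using w(2) norm_diff_ineq[of w \<i>] M by (intro mult_left_mono) auto
      finally show ?thesis
        using nz[of w] w(1) M by (simp add: G_def norm_divide norm_power divide_le_eq)
    qed
  qed (rule z)
  then have "norm (F z) ^ n \<le> M ^ n * norm (z + \<i>)"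
    using nz[OF z] by (auto simp: G_def norm_divide norm_power divide_le_eq split: if_splits)
  with n M show False by (simp add: power_divide field_simps)
qed

text \<open>Makes \<open>exp (- e * z\<^sup>2)\<close> a Gaussian damping factor in the two sectors
  adjacent to the real axis.\<close>

lemma Re_power2_ge_in_sector:
  assumes "0 \<le> Im z" "2 * Im z \<le> \<bar>Re z\<bar>"
  shows "(norm z)\<^sup>2 / 2 \<le> Re (z\<^sup>2)"
proof -
  have "4 * (Im z)\<^sup>2 \<le> (Re z)\<^sup>2"
    using power_mono[OF assms(2), of 2] assms(1) by (simp add: power_mult_distrib)
  moreover have "0 \<le> (Im z)\<^sup>2" by simp
  ultimately have "3 * (Im z)\<^sup>2 \<le> (Re z)\<^sup>2" by linarith
  then show ?thesis
    by (simp add: cmod_power2 Re_power2)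
qed

text \<open>The term \<open>3 * Im z\<close> bounds \<open>F\<close> by \<open>C\<close> where
  \<open>\<bar>Re z\<bar> \<le> 2 * Im z\<close>, since there \<open>norm z \<le> 3 * Im z\<close>.
  In the two remaining sectors a Gaussian factor defeats growth of order one. So \<open>F\<close> is
  bounded on the half-plane, and the principle for bounded functions sharpens the bound to
  \<open>M\<close>.\<close>

lemma phragmen_lindelof_half_plane:
  assumes hol: "F holomorphic_on UNIV" and b: "0 \<le> b"
    and growth: "\<And>z. norm (F z) \<le> C * exp (b * (norm z - 3 * Im z))"
    and real: "\<And>x. norm (F (of_real x)) \<le> M"
    and M: "0 < M" and z: "0 \<le> Im z"
  shows "norm (F z) \<le> M"
proof -
  have C0: "0 \<le> C" using order_trans[OF norm_ge_zero growth[of 0]] by simp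
  have upper: "norm (F w) \<le> C" if "0 \<le> Im w" "\<bar>Re w\<bar> \<le> 2 * Im w" for w
  proof -
    have "norm w \<le> 3 * Im w"
      using cmod_le[of w] that by simp
    then have "b * (norm w - 3 * Im w) \<le> 0"
      using b by (simp add: mult_nonneg_nonpos)
    then show ?thesis
      using growth[of w] mult_left_mono[OF _ C0, of "exp (b * (norm w - 3 * Im w))" 1] by simp
  qed
  define M' where "M' = max C M"
  have M': "0 < M'" "C \<le> M'" "M \<le> M'" using M by (auto simp: M'_def)
  let ?U = "{w. 0 \<le> Im w \<and> 2 * Im w \<le> \<bar>Re w\<bar>}" and ?V = "{w. 0 < Im w \<and> 2 * Im w < \<bar>Re w\<bar>}"
  have sector: "norm (F w) \<le> M'" if w: "w \<in> ?U" for w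
  proof -
    \<comment> \<open>The damping factor has modulus at most 1 on \<open>?U\<close>, so it preserves
      the boundary bound; it is removed afterwards by letting \<open>e\<close> tend to 0.\<close>
    have eps: "norm (exp (- of_real e * w\<^sup>2) * F w) \<le> M'" if e: "0 < e" for e
    proof (rule maximum_modulus_decay[where G = "\<lambda>w. exp (- of_real e * w\<^sup>2) * F w"])
      show "closed ?U" "open ?V"
        by (intro closed_Collect_conj closed_Collect_le open_Collect_conj open_Collect_less continuous_intros)+
      show "?V \<subseteq> ?U" by auto
      show "(\<lambda>w. exp (- of_real e * w\<^sup>2) * F w) holomorphic_on ?U"
        by (intro holomorphic_intros holomorphic_on_subset[OF hol]) auto
      show "norm (exp (- of_real e * v\<^sup>2) * F v) \<le> M'" if v: "v \<in> ?U - ?V" for v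
      proof -
        have "norm (F v) \<le> M'"
        proof (cases "Im v = 0")
          case True
          then have "v = of_real (Re v)" by (simp add: complex_eq_iff)
          then show ?thesis using real[of "Re v"] M' by simp
        next
          case False
          then show ?thesis using upper[of v] v M' by auto
        qed
        moreover have "norm (exp (- of_real e * v\<^sup>2)) \<le> 1"
        proof -
          have "0 \<le> (norm v)\<^sup>2 / 2" by simp
          also have "\<dots> \<le> Re (v\<^sup>2)" using Re_power2_ge_in_sector[of v] v by auto
          finally show ?thesis using e by simp
        qed
        ultimately show ?thesis
          using mult_mono[of _ 1 "norm (F v)" M'] by (simp add: norm_mult)
      qed
      \<comment> \<open>The radius is chosen so that the Gaussian exponent
        \<open>e * (norm v)\<^sup>2 / 2\<close> exceeds \<open>b * norm v\<close> by at least
        \<open>C / M'\<close>.\<close>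
      show "norm (exp (- of_real e * v\<^sup>2) * F v) \<le> M'"
        if v: "v \<in> ?U" "1 + 2 * (b + C / M') / e \<le> norm v" for v
      proof -
        have n1: "1 \<le> norm v" using v(2) b C0 M' e
          by (smt (verit) divide_nonneg_pos)
        have "2 * (b + C / M') \<le> (norm v - 1) * e"
          using v(2) e by (simp add: field_simps)
        then have "2 * (b + C / M') \<le> norm v * e" using e by (simp add: algebra_simps)
        then have "2 * (b + C / M') * norm v \<le> norm v * e * norm v"
          by (intro mult_right_mono) auto
        then have "b * norm v + C / M' * norm v \<le> e * ((norm v)\<^sup>2 / 2)"
          by (simp add: algebra_simps power2_eq_square)
        also have "\<dots> \<le> e * Re (v\<^sup>2)"
          using Re_power2_ge_in_sector[of v] v e by (intro mult_left_mono) auto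
        finally have "- (e * Re (v\<^sup>2)) + b * norm v \<le> - (C / M' * norm v)" by simp
        also have "\<dots> \<le> - (C / M')"
          using n1 C0 M' mult_left_mono[OF n1, of "C / M'"] by simp
        finally have ex: "- (e * Re (v\<^sup>2)) + b * norm v \<le> - (C / M')" .
        have "norm (exp (- of_real e * v\<^sup>2) * F v)
            \<le> exp (- (e * Re (v\<^sup>2))) * (C * exp (b * norm v))"
        proof -
          have "C * exp (b * (norm v - 3 * Im v)) \<le> C * exp (b * norm v)"
            using v(1) b C0 by (intro mult_left_mono) (auto simp: algebra_simps)
          with growth[of v] have "norm (F v) \<le> C * exp (b * norm v)" by linarith
          then show ?thesis by (simp add: norm_mult mult_left_mono)
        qed
        also have "\<dots> = C * exp (- (e * Re (v\<^sup>2)) + b * norm v)"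
          by (simp only: exp_add mult_ac)
        also have "\<dots> \<le> C * exp (- (C / M'))"
          using ex C0 by (simp add: mult_left_mono)
        also have "\<dots> \<le> M'"
        proof -
          have "C / M' \<le> exp (C / M')"
            using exp_ge_add_one_self[of "C / M'"] by linarith
          then show ?thesis
            using M' by (simp add: exp_minus field_simps)
        qed
        finally show ?thesis .
      qed
      show "w \<in> ?U" by (rule w)
    qed
    have "((\<lambda>e. norm (exp (- of_real e * w\<^sup>2) * F w)) \<longlongrightarrow> norm (exp (- of_real 0 * w\<^sup>2) * F w)) (at_right 0)"
      by (intro tendsto_intros)
    moreover have "eventually (\<lambda>e. norm (exp (- of_real e * w\<^sup>2) * F w) \<le> M') (at_right 0)"
      using eps by (intro eventually_at_right_less[THEN eventually_mono])
    ultimately show ?thesis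
      using tendsto_upperbound[of _ _ "at_right (0::real)" M'] by fastforce
  qed
  let ?H = "{w. 0 \<le> Im w}" and ?O = "{w. 0 < Im w}"
  show ?thesis
  \<comment> \<open>Boundedness by \<open>M'\<close> is now known on the whole half-plane, whose
    only boundary is the real axis, where \<open>M\<close> is available.\<close>
  proof (rule phragmen_lindelof_bounded[of ?H ?O F M'])
    show "closed ?H" by (simp add: closed_halfspace_Im_ge)
    show "open ?O" by (simp add: open_halfspace_Im_gt)
    show "F holomorphic_on ?H" by (rule holomorphic_on_subset[OF hol]) auto
    show "norm (F w) \<le> M'" if "w \<in> ?H" for w
      using sector[of w] upper[of w] that M' by force
    show "norm (F w) \<le> M" if "w \<in> ?H - ?O" for w
    proof -
      have "w = of_real (Re w)" using that by (simp add: complex_eq_iff)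
      then show ?thesis using real[of "Re w"] by simp
    qed
  qed (use M z in auto)
qed

section \<open>Mean squares over horizontal lines\<close>

abbreviation line_sq :: "(complex \<Rightarrow> complex) \<Rightarrow> real \<Rightarrow> real \<Rightarrow> real" where
  "line_sq f y t \<equiv> (norm (f (of_real t + \<i> * of_real y)))\<^sup>2"

lemma continuous_on_line_sq:
  assumes "f holomorphic_on UNIV"
  shows "continuous_on A (line_sq f y)"
  by (intro continuous_intros continuous_on_compose2[OF holomorphic_on_imp_continuous_on[OF assms]]) auto

text \<open>Translation invariance of Lebesgue measure makes the bound uniform in the shift
  \<open>x\<close>. This links gauge integrals over segments to Lebesgue integrals over the
  line.\<close>

lemma segment_integral_le:
  fixes g :: "real \<Rightarrow> real"
  assumes cont: "continuous_on UNIV g" and nonneg: "\<And>t. 0 \<le> g t" and int: "integrable lborel g"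
  shows "integral {- R..R} (\<lambda>t. g (x + t)) \<le> (LINT t|lborel. g t)"
proof -
  have si: "set_integrable lborel {- R..R} (\<lambda>t. g (x + t))"
    by (intro borel_integrable_atLeastAtMost' continuous_on_compose2[OF cont] continuous_intros) auto
  have int': "integrable lborel (\<lambda>t. g (x + t))"
    using lborel_integrable_real_affine[OF int, of 1 x] by simp
  have "integral {- R..R} (\<lambda>t. g (x + t)) = (LINT t:{- R..R}|lborel. g (x + t))"
    by (rule set_borel_integral_eq_integral(2)[OF si, symmetric])
  also have "\<dots> \<le> (LINT t|lborel. g (x + t))"
    unfolding set_lebesgue_integral_def
    by (intro integral_mono int' si[unfolded set_integrable_def]) (auto simp: nonneg split: split_indicator)
  also have "\<dots> = (LINT t|lborel. g t)"
    using lborel_integral_real_affine[of 1 g x] by simp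
  finally show ?thesis .
qed

text \<open>Monotone convergence along the segments from \<open>- n\<close> to \<open>n\<close>.
  Integrability is a conclusion, so finiteness on a new line can be derived from segment bounds
  alone.\<close>

lemma integrable_if_segment_integrals_bounded:
  fixes g :: "real \<Rightarrow> real"
  assumes cont: "continuous_on UNIV g" and nonneg: "\<And>t. 0 \<le> g t"
    and bd: "\<And>R. 0 \<le> R \<Longrightarrow> integral {- R..R} g \<le> K"
  shows "integrable lborel g" "(LINT t|lborel. g t) \<le> K"
proof -
  define h where "h n t = indicator {- real n..real n} t * g t" for n t
  have si: "set_integrable lborel {- real n..real n} g" for n
    by (intro borel_integrable_atLeastAtMost' continuous_on_subset[OF cont]) auto
  have h: "integrable lborel (h n)" for n
    using si[of n] unfolding set_integrable_def h_def[abs_def] real_scaleR_def .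
  have le: "integral\<^sup>L lborel (h n) \<le> K" for n
    using set_borel_integral_eq_integral(2)[OF si[of n]] bd[of "real n"]
    by (simp add: h_def[abs_def] set_lebesgue_integral_def)
  have mono: "mono (\<lambda>n. h n t)" for t
    unfolding h_def by (auto intro!: monoI simp: nonneg split: split_indicator)
  have "incseq (\<lambda>n. integral\<^sup>L lborel (h n))"
    by (intro monoI integral_mono h) (use mono in \<open>auto simp: mono_def\<close>)
  with le obtain L where L: "(\<lambda>n. integral\<^sup>L lborel (h n)) \<longlonglongrightarrow> L"
    using incseq_convergent[of "\<lambda>n. integral\<^sup>L lborel (h n)" K] by blast
  have lim: "(\<lambda>n. h n t) \<longlonglongrightarrow> g t" for t
  proof (rule tendsto_eventually, rule eventually_sequentiallyI)
    fix n assume "nat \<lceil>\<bar>t\<bar>\<rceil> \<le> n"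
    then have "\<bar>t\<bar> \<le> real n" by linarith
    then show "h n t = g t" by (auto simp: h_def abs_le_iff)
  qed
  have meas: "g \<in> borel_measurable lborel"
    using borel_measurable_continuous_onI[OF cont] by simp
  note conv = integral_monotone_convergence_nonneg[OF h _ _ _ L meas]
  have nn: "0 \<le> h n t" for n t by (simp add: h_def nonneg)
  show "integrable lborel g"
    by (rule conv(1)) (use mono lim nn in auto)
  have "integral\<^sup>L lborel g = L"
    by (rule conv(2)) (use mono lim nn in auto)
  with LIMSEQ_le_const2[OF L] le show "(LINT t|lborel. g t) \<le> K" by auto
qed

text \<open>
  Pairing the translates of \<open>f\<close> with a segment of \<open>f\<close> itself turns mean-square bounds
  into pointwise bounds for one entire function, to which the maximum principle applies.
\<close>

lemma line_correlation:
  assumes hol: "f holomorphic_on UNIV" and R: "0 \<le> R"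
  obtains F L where "F holomorphic_on UNIV" "0 \<le> L"
    "F (\<i> * of_real y\<^sub>0) = of_real (integral {- R..R} (line_sq f y\<^sub>0))"
    "\<And>z B. (\<And>t. \<bar>t\<bar> \<le> R \<Longrightarrow> norm (f (z + of_real t)) \<le> B) \<Longrightarrow> norm (F z) \<le> B * L"
    "\<And>z. integrable lborel (line_sq f (Im z)) \<Longrightarrow>
       norm (F z) \<le> ((LINT t|lborel. line_sq f (Im z) t) + integral {- R..R} (line_sq f y\<^sub>0)) / 2"
proof
  have cont: "continuous_on UNIV f"
    by (rule holomorphic_on_imp_continuous_on[OF hol])
  \<comment> \<open>With this weight, \<open>F\<close> correlates \<open>f\<close> on the line
    through \<open>z\<close> with the segment at height \<open>y\<^sub>0\<close>. At
    \<open>z = \<i> * y\<^sub>0\<close> the integrand becomes the squared modulus of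
    \<open>f\<close>.\<close>
  define h where "h t = cnj (f (of_real t + \<i> * of_real y\<^sub>0))" for t :: real
  define F where "F z = integral {- R..R} (\<lambda>t. f (z + of_real t) * h t)" for z
  define L where "L = integral {- R..R} (\<lambda>t. norm (h t))"
  have cf: "continuous_on A (\<lambda>t. f (z + of_real t))" for A :: "real set" and z
    by (intro continuous_intros continuous_on_compose2[OF cont]) auto
  have ch: "continuous_on A h" for A
    unfolding h_def by (intro continuous_intros continuous_on_compose2[OF cont]) auto
  have hsq: "(norm (h t))\<^sup>2 = line_sq f y\<^sub>0 t" for t
    by (simp add: h_def)
  have dhol: "deriv f holomorphic_on UNIV"
    by (intro holomorphic_deriv hol) auto
  show "F holomorphic_on UNIV"
    unfolding F_def interval_cbox
  proof (rule leibniz_rule_holomorphic[where fx = "\<lambda>z t. deriv f (z + of_real t) * h t"])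
    show "((\<lambda>z. f (z + of_real t) * h t) has_field_derivative deriv f (z + of_real t) * h t) (at z within UNIV)"
      for z t
    proof -
      have "(f has_field_derivative deriv f (z + of_real t)) (at (z + of_real t))"
        by (rule holomorphic_derivI[OF hol]) auto
      then have "((\<lambda>z. f (z + of_real t)) has_field_derivative deriv f (z + of_real t)) (at z)"
        by (simp add: DERIV_shift)
      then show ?thesis by (rule DERIV_cmult_right)
    qed
    show "(\<lambda>t. f (z + of_real t) * h t) integrable_on cbox (- R) R" for z
      by (intro integrable_continuous continuous_intros cf ch)
    show "continuous_on (UNIV \<times> cbox (- R) R) (\<lambda>(z, t). deriv f (z + of_real t) * h t)"
      unfolding case_prod_unfold
      by (intro continuous_intros continuous_on_compose2[OF ch]
            continuous_on_compose2[OF holomorphic_on_imp_continuous_on[OF dhol]]) auto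
  qed auto
  show "0 \<le> L"
    unfolding L_def by (intro integral_nonneg integrable_continuous_real continuous_intros ch) auto
  show "F (\<i> * of_real y\<^sub>0) = of_real (integral {- R..R} (line_sq f y\<^sub>0))"
  proof -
    have "((\<lambda>t. of_real (line_sq f y\<^sub>0 t) :: complex) has_integral of_real (integral {- R..R} (line_sq f y\<^sub>0))) {- R..R}"
      by (intro has_integral_of_real integrable_integral integrable_continuous_real
            continuous_on_line_sq hol)
    moreover have "of_real (line_sq f y\<^sub>0 t) = f (\<i> * of_real y\<^sub>0 + of_real t) * h t" for t
      unfolding h_def complex_norm_square by (simp add: add.commute)
    ultimately show ?thesis
      by (simp add: F_def integral_unique)
  qed
  show "norm (F z) \<le> B * L" if B: "\<And>t. \<bar>t\<bar> \<le> R \<Longrightarrow> norm (f (z + of_real t)) \<le> B" for z B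
  proof -
    have "norm (F z) \<le> integral {- R..R} (\<lambda>t. B * norm (h t))"
      unfolding F_def
      by (intro Henstock_Kurzweil_Integration.integral_norm_bound_integral
            integrable_continuous_real continuous_intros cf ch)
         (auto simp: norm_mult abs_le_iff intro!: mult_right_mono B)
    then show ?thesis by (simp add: L_def)
  qed
  \<comment> \<open>The inequality \<open>2 * x * y \<le> x\<^sup>2 + y\<^sup>2\<close> replaces
    Cauchy-Schwarz. The arithmetic mean is good enough: from \<open>J \<le> (K + J) / 2\<close>
    follows \<open>J \<le> K\<close>.\<close>
  show "norm (F z) \<le> ((LINT t|lborel. line_sq f (Im z) t) + integral {- R..R} (line_sq f y\<^sub>0)) / 2"
    if int: "integrable lborel (line_sq f (Im z))" for z
  proof -
    have z: "z + of_real t = of_real (Re z + t) + \<i> * of_real (Im z)" for t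
      by (simp add: complex_eq_iff)
    have cl: "continuous_on {- R..R} (\<lambda>t. line_sq f (Im z) (Re z + t))"
      by (rule continuous_on_compose2[OF continuous_on_line_sq[OF hol, of UNIV]])
        (auto intro!: continuous_intros)
    have cl0: "continuous_on {- R..R} (line_sq f y\<^sub>0)"
      by (rule continuous_on_line_sq[OF hol])
    have "norm (F z) \<le> integral {- R..R} (\<lambda>t. (line_sq f (Im z) (Re z + t) + line_sq f y\<^sub>0 t) / 2)"
      unfolding F_def
    proof (intro Henstock_Kurzweil_Integration.integral_norm_bound_integral
            integrable_continuous_real)
      show "continuous_on {- R..R} (\<lambda>t. (line_sq f (Im z) (Re z + t) + line_sq f y\<^sub>0 t) / 2)"
        by (intro continuous_intros cl cl0) auto
      show "norm (f (z + of_real t) * h t) \<le> (line_sq f (Im z) (Re z + t) + line_sq f y\<^sub>0 t) / 2" for t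
        using sum_squares_bound[of "norm (f (z + of_real t))" "norm (h t)"]
        unfolding norm_mult hsq[symmetric] z[symmetric] by simp
    qed (intro continuous_intros cf ch)
    also have "\<dots> = (integral {- R..R} (\<lambda>t. line_sq f (Im z) (Re z + t)) + integral {- R..R} (line_sq f y\<^sub>0)) / 2"
      by (simp only: Henstock_Kurzweil_Integration.integral_divide
            Henstock_Kurzweil_Integration.integral_add[OF integrable_continuous_real[OF cl]
              integrable_continuous_real[OF cl0]])
    also have "\<dots> \<le> ((LINT t|lborel. line_sq f (Im z) t) + integral {- R..R} (line_sq f y\<^sub>0)) / 2"
      using segment_integral_le[OF continuous_on_line_sq[OF hol] _ int] by simp
    finally show ?thesis .
  qed
qed

text \<open>A segment integral \<open>J\<close> at height \<open>y\<close> exceeding the energy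
  \<open>K\<close> of the real axis is contradictory: the correlation \<open>F\<close> is bounded by
  \<open>(K + J) / 2\<close> on the real axis, hence in the half-plane, yet takes the value
  \<open>J\<close> at \<open>\<i> * y\<close>.\<close>

lemma line_energy_half_plane:
  assumes hol: "f holomorphic_on UNIV" and b: "0 \<le> b"
    and growth: "\<And>z. norm (f z) \<le> C * exp (b * (norm z - 3 * Im z))"
    and int: "integrable lborel (line_sq f 0)" and y: "0 \<le> y"
  shows "integrable lborel (line_sq f y)"
    and "(LINT t|lborel. line_sq f y t) \<le> (LINT t|lborel. line_sq f 0 t)"
proof -
  have C0: "0 \<le> C" using order_trans[OF norm_ge_zero growth[of 0]] by simp
  define K where "K = (LINT t|lborel. line_sq f 0 t)"
  have bd: "integral {- R..R} (line_sq f y) \<le> K" if R: "0 \<le> R" for R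
  proof (rule ccontr)
    define J where "J = integral {- R..R} (line_sq f y)"
    assume "\<not> integral {- R..R} (line_sq f y) \<le> K"
    then have J: "K < J" by (simp add: J_def)
    have "0 \<le> K" by (simp add: K_def)
    obtain F L where F: "F holomorphic_on UNIV" "0 \<le> L" "F (\<i> * of_real y) = of_real J"
      "\<And>z B. (\<And>t. \<bar>t\<bar> \<le> R \<Longrightarrow> norm (f (z + of_real t)) \<le> B) \<Longrightarrow> norm (F z) \<le> B * L"
      "\<And>z. integrable lborel (line_sq f (Im z)) \<Longrightarrow>
         norm (F z) \<le> ((LINT t|lborel. line_sq f (Im z) t) + J) / 2"
      using line_correlation[OF hol R, of y] unfolding J_def by blast
    have "norm (F (\<i> * of_real y)) \<le> (K + J) / 2"
    proof (rule phragmen_lindelof_half_plane[OF F(1) b])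
      fix z
      \<comment> \<open>A real shift by at most \<open>R\<close> leaves \<open>Im z\<close>
        unchanged and costs a factor of at most \<open>exp (b * R)\<close>, so \<open>F\<close>
        inherits the growth bound of \<open>f\<close> with a larger constant.\<close>
      have "norm (F z) \<le> C * exp (b * R + b * (norm z - 3 * Im z)) * L"
      proof (rule F(4))
        fix t :: real assume "\<bar>t\<bar> \<le> R"
        then have "norm (z + of_real t) \<le> norm z + R"
          using norm_triangle_ineq[of z "of_real t"] by simp
        then have "b * (norm (z + of_real t) - 3 * Im z) \<le> b * R + b * (norm z - 3 * Im z)"
          using b by (simp add: distrib_left[symmetric] mult_left_mono)
        then have "C * exp (b * (norm (z + of_real t) - 3 * Im z))
            \<le> C * exp (b * R + b * (norm z - 3 * Im z))"
          using C0 by (intro mult_left_mono) auto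
        with growth[of "z + of_real t"]
        show "norm (f (z + of_real t)) \<le> C * exp (b * R + b * (norm z - 3 * Im z))" by simp
      qed
      then show "norm (F z) \<le> (C * exp (b * R) * L) * exp (b * (norm z - 3 * Im z))"
        by (simp only: exp_add mult_ac)
    next
      show "norm (F (of_real x)) \<le> (K + J) / 2" for x
        using F(5)[of "of_real x"] int by (simp add: K_def)
    qed (use \<open>0 \<le> K\<close> J y in auto)
    then show False using F(3) J \<open>0 \<le> K\<close> by simp
  qed
  note * = integrable_if_segment_integrals_bounded[OF continuous_on_line_sq[OF hol] _ bd]
  show "integrable lborel (line_sq f y)" by (rule *(1)) auto
  show "(LINT t|lborel. line_sq f y t) \<le> (LINT t|lborel. line_sq f 0 t)"
    unfolding K_def[symmetric] by (rule *(2)) auto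
qed

section \<open>Paley-Wiener functions on horizontal lines\<close>

lemma paley_wiener_holomorphic: "f \<in> paley_wiener a \<Longrightarrow> f holomorphic_on UNIV"
  by (simp add: paley_wiener_def)

text \<open>
  The factor \<open>exp (3 i b z)\<close> with \<open>b = a + 1\<close> has modulus one on the real axis and makes
  \<open>f\<close> bounded wherever \<open>\<bar>Re z\<bar> \<le> 2 Im z\<close>.
\<close>

lemma plancherel_polya_upper:
  assumes a: "0 \<le> a" and f: "f \<in> paley_wiener a" and y: "0 \<le> y"
  shows "integrable lborel (line_sq f y)"
    and "(LINT t|lborel. line_sq f y t)
           \<le> exp (6 * (a + 1) * y) * (LINT t|lborel. line_sq f 0 t)"
proof -
  define b where "b = a + 1"
  have hol: "f holomorphic_on UNIV" by (rule paley_wiener_holomorphic[OF f])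
  define g where "g z = f z * exp (3 * \<i> * of_real b * z)" for z
  \<comment> \<open>On the line at height \<open>v\<close> the factor has squared modulus
    \<open>exp (- (6 * b * v))\<close>; this is the source of the 6 in the estimate.\<close>
  have sq: "line_sq g v t = exp (- (6 * b * v)) * line_sq f v t" for v t
    by (simp add: g_def norm_mult power_mult_distrib mult.commute flip: exp_of_nat_mult)
  \<comment> \<open>The type condition is used with \<open>\<epsilon> = 1\<close>.\<close>
  obtain C where C: "\<And>z. norm (f z) \<le> C * exp (b * norm z)"
    using f unfolding paley_wiener_def exponential_type_le_def b_def mem_Collect_eq
    by (meson zero_less_one)
  have "g holomorphic_on UNIV"
    unfolding g_def by (intro holomorphic_intros hol)
  moreover have "norm (g z) \<le> C * exp (b * (norm z - 3 * Im z))" for z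
  proof -
    have "norm (g z) = norm (f z) * exp (- (3 * b * Im z))"
      by (simp add: g_def norm_mult)
    also have "\<dots> \<le> C * exp (b * norm z) * exp (- (3 * b * Im z))"
      by (intro mult_right_mono C) auto
    also have "\<dots> = C * exp (b * (norm z - 3 * Im z))"
      by (simp add: exp_add[symmetric] algebra_simps)
    finally show ?thesis .
  qed
  moreover have "integrable lborel (line_sq g 0)"
    unfolding sq using f by (simp add: paley_wiener_def)
  moreover have "0 \<le> b" using a by (simp add: b_def)
  ultimately have g: "integrable lborel (line_sq g y)"
    "(LINT t|lborel. line_sq g y t) \<le> (LINT t|lborel. line_sq g 0 t)"
    using line_energy_half_plane y by blast+
  from g(1) show "integrable lborel (line_sq f y)"
    unfolding sq by simp
  from g(2) have "(LINT t|lborel. line_sq f y t) / exp (6 * b * y) \<le> (LINT t|lborel. line_sq f 0 t)"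
    unfolding sq by (simp add: exp_minus divide_inverse mult.commute)
  then show "(LINT t|lborel. line_sq f y t)
           \<le> exp (6 * (a + 1) * y) * (LINT t|lborel. line_sq f 0 t)"
    by (simp add: b_def pos_divide_le_eq mult.commute)
qed

text \<open>Replacing \<open>z\<close> by \<open>- z\<close> exchanges the half-planes and preserves
  the space, so results for heights \<open>y \<ge> 0\<close> carry over to negative heights.\<close>

lemma line_sq_reflect: "line_sq (\<lambda>z. f (- z)) y t = line_sq f (- y) (- t)"
  by simp

lemma integrable_line_sq_reflect:
  "integrable lborel (line_sq (\<lambda>z. f (- z)) y) \<longleftrightarrow> integrable lborel (line_sq f (- y))"
  unfolding line_sq_reflect
  using lborel_integrable_real_affine_iff[of "- 1" "line_sq f (- y)" 0] by simp

lemma lint_line_sq_reflect: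
  "(LINT t|lborel. line_sq (\<lambda>z. f (- z)) y t) = (LINT t|lborel. line_sq f (- y) t)"
  unfolding line_sq_reflect
  using lborel_integral_real_affine[of "- 1" "line_sq f (- y)" 0] by simp

lemma paley_wiener_reflect:
  assumes f: "f \<in> paley_wiener a"
  shows "(\<lambda>z. f (- z)) \<in> paley_wiener a"
proof -
  have "(f \<circ> uminus) holomorphic_on UNIV"
    by (intro holomorphic_on_compose holomorphic_on_subset[OF paley_wiener_holomorphic[OF f]]
          holomorphic_intros) auto
  moreover have "exponential_type_le a (\<lambda>z. f (- z))"
    using f unfolding paley_wiener_def exponential_type_le_def mem_Collect_eq
    by (metis norm_minus_cancel)
  moreover have "integrable lborel (\<lambda>t::real. (norm (f (- of_real t)))\<^sup>2)"
    using integrable_line_sq_reflect[of f 0] f by (simp add: paley_wiener_def)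
  ultimately show ?thesis
    by (simp add: paley_wiener_def comp_def)
qed

lemma integrable_line_sq:
  assumes "0 \<le> a" and f: "f \<in> paley_wiener a"
  shows "integrable lborel (line_sq f y)"
  using plancherel_polya_upper(1)[OF assms, of y]
    plancherel_polya_upper(1)[OF assms(1) paley_wiener_reflect[OF f], of "- y"]
    integrable_line_sq_reflect[of f "- y"]
  by (cases "0 \<le> y") auto

text \<open>The same contradiction as in the half-plane, now in a strip. The Plancherel-Polya
  estimate bounds the correlation \<open>F\<close> throughout the strip, so the principle for
  bounded functions applies with the two edges as boundary.\<close>

lemma three_lines_mean_square:
  assumes a: "0 \<le> a" and f: "f \<in> paley_wiener a" and y: "0 \<le> y" "y \<le> m"
  shows "(LINT t|lborel. line_sq f y t)
           \<le> max (LINT t|lborel. line_sq f 0 t) (LINT t|lborel. line_sq f m t)"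
    (is "_ \<le> ?K")
proof (rule integrable_if_segment_integrals_bounded(2))
  have hol: "f holomorphic_on UNIV" by (rule paley_wiener_holomorphic[OF f])
  show "continuous_on UNIV (line_sq f y)" by (rule continuous_on_line_sq[OF hol])
  show "integral {- R..R} (line_sq f y) \<le> ?K" if R: "0 \<le> R" for R
  proof (rule ccontr)
    define J where "J = integral {- R..R} (line_sq f y)"
    assume "\<not> integral {- R..R} (line_sq f y) \<le> ?K"
    then have J: "?K < J" unfolding J_def not_le .
    have K0: "0 \<le> ?K" by (simp add: le_max_iff_disj)
    obtain F L where F: "F holomorphic_on UNIV" "0 \<le> L" "F (\<i> * of_real y) = of_real J"
      "\<And>z B. (\<And>t. \<bar>t\<bar> \<le> R \<Longrightarrow> norm (f (z + of_real t)) \<le> B) \<Longrightarrow> norm (F z) \<le> B * L"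
      "\<And>z. integrable lborel (line_sq f (Im z)) \<Longrightarrow>
         norm (F z) \<le> ((LINT t|lborel. line_sq f (Im z) t) + J) / 2"
      using line_correlation[OF hol R, of y] unfolding J_def by blast
    \<comment> \<open>The a priori bound for \<open>F\<close>: the Plancherel-Polya factor is
      largest at the top height \<open>m\<close>.\<close>
    define C where "C = (exp (6 * (a + 1) * m) * (LINT t|lborel. line_sq f 0 t) + J) / 2"
    let ?U = "{z. 0 \<le> Im z \<and> Im z \<le> m}" and ?V = "{z. 0 < Im z \<and> Im z < m}"
    have "norm (F (\<i> * of_real y)) \<le> (?K + J) / 2"
    proof (rule phragmen_lindelof_bounded[of ?U ?V F C])
      show "closed ?U" "open ?V"
        by (intro closed_Collect_conj closed_Collect_le open_Collect_conj open_Collect_less continuous_intros)+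
      show "?V \<subseteq> ?U" by auto
      show "F holomorphic_on ?U" by (rule holomorphic_on_subset[OF F(1)]) auto
      show "norm (F z) \<le> C" if z: "z \<in> ?U" for z
      proof -
        have "(LINT t|lborel. line_sq f (Im z) t)
            \<le> exp (6 * (a + 1) * Im z) * (LINT t|lborel. line_sq f 0 t)"
          using z by (intro plancherel_polya_upper(2)[OF a f]) auto
        also have "\<dots> \<le> exp (6 * (a + 1) * m) * (LINT t|lborel. line_sq f 0 t)"
          using z a by (intro mult_right_mono) auto
        finally show ?thesis
          using F(5)[OF integrable_line_sq[OF a f], of z] by (simp add: C_def)
      qed
      show "norm (F z) \<le> (?K + J) / 2" if "z \<in> ?U - ?V" for z
      proof -
        have "Im z = 0 \<or> Im z = m" using that by auto
        then have le: "(LINT t|lborel. line_sq f (Im z) t) \<le> ?K" by auto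
        have "norm (F z) \<le> ((LINT t|lborel. line_sq f (Im z) t) + J) / 2"
          by (rule F(5)[OF integrable_line_sq[OF a f]])
        also have "\<dots> \<le> (?K + J) / 2"
          by (intro divide_right_mono add_right_mono le) simp
        finally show ?thesis .
      qed
    qed (use K0 J y in auto)
    then have "J \<le> (?K + J) / 2"
      unfolding F(3) norm_of_real by (rule order_trans[OF abs_ge_self])
    then have "J \<le> ?K" by simp
    with J show False by (rule leD[THEN notE, rotated])
  qed
qed auto

text \<open>By the identity theorem \<open>f\<close> cannot vanish on the whole line at height
  \<open>p\<close>. Continuity at a nonzero value keeps the modulus above a positive constant on a
  small box, and every line crossing the box picks up a fixed amount of energy.\<close>

lemma line_energy_bounded_below:
  assumes hol: "f holomorphic_on UNIV" and nz: "f w \<noteq> 0"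
  obtains \<delta> r where "0 < \<delta>" "0 < r"
    "\<And>y. \<bar>y - p\<bar> < r \<Longrightarrow> integrable lborel (line_sq f y) \<Longrightarrow> \<delta> \<le> (LINT t|lborel. line_sq f y t)"
proof -
  have "\<exists>z. Im z = p \<and> f z \<noteq> 0"
  proof (rule ccontr)
    assume *: "\<not> (\<exists>z. Im z = p \<and> f z \<noteq> 0)"
    have lim: "\<i> * of_real p islimpt {z. Im z = p}"
      unfolding islimpt_approachable
    proof (intro allI impI)
      fix e :: real assume "0 < e"
      then show "\<exists>z\<in>{z. Im z = p}. z \<noteq> \<i> * of_real p \<and> dist z (\<i> * of_real p) < e"
        by (intro bexI[of _ "\<i> * of_real p + of_real (e / 2)"]) (auto simp: dist_norm norm_divide)
    qed
    have "f w = 0"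
      by (rule analytic_continuation[OF hol open_UNIV connected_UNIV subset_UNIV UNIV_I lim _ UNIV_I])
         (use * in auto)
    with nz show False by simp
  qed
  then obtain z\<^sub>0 where z0: "Im z\<^sub>0 = p" "f z\<^sub>0 \<noteq> 0" by blast
  define \<eta> where "\<eta> = norm (f z\<^sub>0) / 2"
  have \<eta>: "0 < \<eta>" using z0 by (simp add: \<eta>_def)
  have "isCont f z\<^sub>0"
    using holomorphic_on_imp_continuous_on[OF hol] by (simp add: continuous_on_eq_continuous_at)
  then obtain s where s: "0 < s" "\<And>z. dist z z\<^sub>0 < s \<Longrightarrow> dist (f z) (f z\<^sub>0) < \<eta>"
    using \<eta> unfolding continuous_at_eps_delta by blast
  \<comment> \<open>Half the radius \<open>s\<close> goes to each coordinate, since the distance is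
    at most the sum of the two offsets.\<close>
  have near: "\<eta>\<^sup>2 \<le> line_sq f y t" if "\<bar>y - p\<bar> < s / 2" "t \<in> {Re z\<^sub>0 - s / 2..Re z\<^sub>0 + s / 2}" for y t
  proof -
    have "dist (of_real t + \<i> * of_real y) z\<^sub>0 \<le> \<bar>t - Re z\<^sub>0\<bar> + \<bar>y - p\<bar>"
      using cmod_le[of "of_real t + \<i> * of_real y - z\<^sub>0"] z0(1) by (simp add: dist_norm)
    also have "\<dots> < s"
    proof -
      have "\<bar>t - Re z\<^sub>0\<bar> \<le> s / 2" using that(2) unfolding atLeastAtMost_iff by linarith
      with that(1) show ?thesis by linarith
    qed
    finally have "dist (f (of_real t + \<i> * of_real y)) (f z\<^sub>0) < \<eta>" by (rule s(2))
    then have "norm (f z\<^sub>0) - norm (f (of_real t + \<i> * of_real y)) < \<eta>"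
      by (metis dist_norm norm_minus_commute norm_triangle_ineq2 order_le_less_trans)
    then have "\<eta> \<le> norm (f (of_real t + \<i> * of_real y))" by (simp add: \<eta>_def)
    then show ?thesis using \<eta> by (intro power_mono) auto
  qed
  show ?thesis
  proof
    \<comment> \<open>The energy bound is the length \<open>s\<close> of the interval times the
      lower bound \<open>\<eta>\<^sup>2\<close> on it.\<close>
    show "0 < s * \<eta>\<^sup>2" "0 < s / 2" using s(1) \<eta> by auto
    show "s * \<eta>\<^sup>2 \<le> (LINT t|lborel. line_sq f y t)"
      if y: "\<bar>y - p\<bar> < s / 2" and int: "integrable lborel (line_sq f y)" for y
    proof -
      have "s * \<eta>\<^sup>2 = (LINT t|lborel. indicator {Re z\<^sub>0 - s / 2..Re z\<^sub>0 + s / 2} t * \<eta>\<^sup>2)"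
        using s(1) by simp
      also have "\<dots> \<le> (LINT t|lborel. line_sq f y t)"
        using near[OF y]
        by (intro integral_mono int integrable_mult_left integrable_real_indicator)
           (auto simp: emeasure_lborel_Icc_eq split: split_indicator)
      finally show ?thesis .
    qed
  qed
qed

section \<open>Norms along orbits\<close>

lemma pw_norm_eq: "pw_norm f = sqrt (LINT t|lborel. (norm (f (of_real t)))\<^sup>2)"
  by (simp add: pw_norm_def pw_inner_def complex_norm_square[symmetric] flip: of_real_power)

text \<open>The substitution \<open>Re w + c * t\<close> absorbs the real part of the shift and
  contributes the Jacobian \<open>\<bar>c\<bar>\<close>; only the height \<open>Im w\<close>
  survives.\<close>

lemma pw_norm_affine:
  assumes "c \<noteq> 0"
  shows "pw_norm (\<lambda>z. f (of_real c * z + w)) = sqrt ((LINT t|lborel. line_sq f (Im w) t) / \<bar>c\<bar>)"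
proof -
  have "of_real c * of_real t + w = of_real (Re w + c * t) + \<i> * of_real (Im w)" for t
    by (simp add: complex_eq_iff)
  then have "pw_norm (\<lambda>z. f (of_real c * z + w)) = sqrt (LINT t|lborel. line_sq f (Im w) (Re w + c * t))"
    unfolding pw_norm_eq by presburger
  then show ?thesis
    using lborel_integral_real_affine[OF assms, of "line_sq f (Im w)" "Re w"] assms by simp
qed

lemma composition_operator_funpow: "(composition_operator \<phi> ^^ n) f = f \<circ> (\<phi> ^^ n)"
proof (induction n)
  case (Suc n)
  have "(composition_operator \<phi> ^^ Suc n) f = composition_operator \<phi> ((composition_operator \<phi> ^^ n) f)"
    by simp
  also have "\<dots> = f \<circ> (\<phi> ^^ n \<circ> \<phi>)"
    unfolding Suc by (simp only: composition_operator_def comp_assoc)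
  finally show ?case by (simp only: funpow_Suc_right)
qed simp

lemma limsup_neq_PInf:
  assumes "\<And>n. a n \<le> B"
  shows "limsup (\<lambda>n. ereal (a n)) \<noteq> \<infinity>"
proof -
  have "limsup (\<lambda>n. ereal (a n)) \<le> ereal B"
    by (intro Limsup_bounded always_eventually) (simp add: assms)
  then show ?thesis by auto
qed

lemma liminf_neq_0:
  assumes "0 < \<delta>" "eventually (\<lambda>n. \<delta> \<le> a n) sequentially"
  shows "liminf (\<lambda>n. ereal (a n)) \<noteq> 0"
proof -
  have "ereal \<delta> \<le> liminf (\<lambda>n. ereal (a n))"
    by (intro Liminf_bounded) (use assms(2) in simp)
  then show ?thesis using assms(1) by auto
qed

text \<open>If \<open>a k\<close> exceeded \<open>a 0\<close>, the maximum would have to be attained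
  by \<open>a m\<close> for every \<open>m \<ge> k\<close>, so the sequence would stay above the
  positive number \<open>a k\<close> from there on.\<close>

lemma bounded_if_le_max_ends:
  fixes a :: "nat \<Rightarrow> real"
  assumes nonneg: "\<And>n. 0 \<le> a n" and max: "\<And>k m. k \<le> m \<Longrightarrow> a k \<le> max (a 0) (a m)"
    and liminf: "liminf (\<lambda>n. ereal (a n)) = 0"
  shows "a k \<le> a 0"
proof (rule ccontr)
  assume *: "\<not> a k \<le> a 0"
  have "eventually (\<lambda>m. a k \<le> a m) sequentially"
    using max[of k] * by (intro eventually_sequentiallyI[of k]) fastforce
  moreover have "0 < a k" using * nonneg[of 0] by linarith
  ultimately show False using liminf_neq_0 liminf by blast
qed

theorem proposition4p5:
  fixes a c :: real and d :: complex
  assumes "0 < a" and "0 < \<bar>c\<bar>" and "\<bar>c\<bar> \<le> 1"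
  shows "\<not> li_yorke_chaotic (paley_wiener a) pw_norm
             (composition_operator (\<lambda>z. of_real c * z + d))"
proof -
  let ?\<phi> = "\<lambda>z. of_real c * z + d"
  have False if f: "f \<in> paley_wiener a"
    and liminf: "liminf (\<lambda>n. ereal (pw_norm (f \<circ> (?\<phi> ^^ n)))) = 0"
    and limsup: "limsup (\<lambda>n. ereal (pw_norm (f \<circ> (?\<phi> ^^ n)))) = \<infinity>" for f
  proof -
    have a: "0 \<le> a" and hol: "f holomorphic_on UNIV"
      using assms(1) paley_wiener_holomorphic[OF f] by auto
    consider "c = 1" | "c = - 1" | "\<bar>c\<bar> < 1" using assms(3) by linarith
    then show False
    proof cases
      case 1
      have iter: "?\<phi> ^^ n = (\<lambda>z. z + of_nat n * d)" for n
      proof (induction n)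
        case (Suc n)
        show ?case
          unfolding funpow.simps Suc comp_def by (simp add: 1 algebra_simps)
      qed (simp add: id_def)
      define e where "e n = (LINT t|lborel. line_sq f (real n * Im d) t)" for n
      have norm: "pw_norm (f \<circ> (?\<phi> ^^ n)) = sqrt (e n)" for n
      proof -
        have "f \<circ> (?\<phi> ^^ n) = (\<lambda>z. f (of_real 1 * z + of_nat n * d))"
          unfolding iter comp_def by simp
        then show ?thesis
          using pw_norm_affine[of 1 f "of_nat n * d"] by (simp only:) (simp add: e_def)
      qed
      \<comment> \<open>The heights \<open>n * Im d\<close> move monotonically away from 0, so the
        three lines theorem applies; for \<open>Im d < 0\<close> it is applied to the reflected
        function.\<close>
      have "e k \<le> max (e 0) (e m)" if km: "k \<le> m" for k m
      proof (cases "0 \<le> Im d")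
        case True
        with km three_lines_mean_square[OF a f, of "real k * Im d" "real m * Im d"]
        show ?thesis by (simp add: e_def mult_right_mono)
      next
        case False
        with km three_lines_mean_square[OF a paley_wiener_reflect[OF f],
            of "- (real k * Im d)" "- (real m * Im d)"]
        show ?thesis
          unfolding lint_line_sq_reflect
          by (simp add: e_def mult_right_mono_neg mult_nonneg_nonpos)
      qed
      then have "sqrt (e k) \<le> max (sqrt (e 0)) (sqrt (e m))" if "k \<le> m" for k m
        using that[THEN \<open>\<And>m k. k \<le> m \<Longrightarrow> e k \<le> max (e 0) (e m)\<close>] by (auto simp: le_max_iff_disj)
      then have bd: "sqrt (e k) \<le> sqrt (e 0)" for k
        by (intro bounded_if_le_max_ends[of "\<lambda>n. sqrt (e n)"]) (use liminf in \<open>auto simp: norm e_def\<close>)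
      show False
        using limsup_neq_PInf[OF bd] limsup unfolding norm by simp
    next
      case 2
      \<comment> \<open>For \<open>c = - 1\<close> the symbol is an involution, so the orbit has at
        most two members.\<close>
      have iter: "?\<phi> ^^ n = id \<or> ?\<phi> ^^ n = ?\<phi>" for n
        by (induction n) (auto simp: 2 fun_eq_iff)
      have bd: "pw_norm (f \<circ> (?\<phi> ^^ n)) \<le> max (pw_norm f) (pw_norm (f \<circ> ?\<phi>))" for n
        using iter[of n] by (rule disjE) (simp_all only: comp_id max.cobounded1 max.cobounded2)
      show False using limsup_neq_PInf[OF bd] limsup by simp
    next
      case 3
      \<comment> \<open>The fixed point of the symbol; about it the iterates are plain scalings by
        \<open>c ^ n\<close>.\<close>
      define p where "p = d / (1 - of_real c)"
      have "of_real c \<noteq> (1 :: complex)" using 3 by auto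
      then have "d = p * (1 - of_real c)" by (simp add: p_def)
      then have d: "d = p - of_real c * p" by (simp add: algebra_simps)
      have iter: "?\<phi> ^^ n = (\<lambda>z. of_real (c ^ n) * z + (p - of_real (c ^ n) * p))" for n
      proof (induction n)
        case (Suc n)
        show ?case
          unfolding funpow.simps Suc comp_def by (simp add: d algebra_simps)
      qed (simp add: id_def)
      have Im_iter: "Im (p - of_real (c ^ n) * p) = Im p - c ^ n * Im p" for n
        by simp
      define e where "e n = (LINT t|lborel. line_sq f (Im p - c ^ n * Im p) t)" for n
      have norm: "pw_norm (f \<circ> (?\<phi> ^^ n)) = sqrt (e n / \<bar>c\<bar> ^ n)" for n
      proof -
        have cn: "c ^ n \<noteq> 0" using assms(2) by simp
        show ?thesis
          unfolding iter comp_def pw_norm_affine[OF cn] Im_iter e_def power_abs ..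
      qed
      show False
      proof (cases "\<exists>w. f w \<noteq> 0")
        case True
        then obtain w where w: "f w \<noteq> 0" by blast
        obtain \<delta> r where \<delta>: "0 < \<delta>" "0 < r"
          "\<And>y. \<bar>y - Im p\<bar> < r \<Longrightarrow> integrable lborel (line_sq f y) \<Longrightarrow>
             \<delta> \<le> (LINT t|lborel. line_sq f y t)"
          using line_energy_bounded_below[OF hol w, of "Im p"] by blast
        \<comment> \<open>The heights of the orbit converge to the height of the fixed point, hence
          eventually lie in the range of the energy bound \<open>\<delta>\<close>.\<close>
        have "(\<lambda>n. Im p - c ^ n * Im p) \<longlonglongrightarrow> Im p - 0 * Im p"
          using 3 by (intro tendsto_intros LIMSEQ_power_zero) auto
        then have "eventually (\<lambda>n. dist (Im p - c ^ n * Im p) (Im p) < r) sequentially"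
          using \<delta>(2) by (simp add: tendsto_iff)
        then have bd: "eventually (\<lambda>n. sqrt \<delta> \<le> pw_norm (f \<circ> (?\<phi> ^^ n))) sequentially"
        proof eventually_elim
          case (elim n)
          then have "\<delta> \<le> e n"
            unfolding e_def dist_real_def by (intro \<delta>(3) integrable_line_sq[OF a f])
          \<comment> \<open>Division by \<open>\<bar>c\<bar> ^ n\<close>, which is at most 1, can
            only enlarge the nonnegative energy.\<close>
          also have "\<dots> \<le> e n / \<bar>c\<bar> ^ n"
          proof -
            have "\<bar>c\<bar> ^ n \<le> 1" using assms(3) by (simp add: power_le_one)
            moreover have "0 < \<bar>c\<bar> ^ n" using assms(2) by simp
            moreover have "0 \<le> e n" by (simp add: e_def)
            ultimately show ?thesis by (simp add: le_divide_eq mult_left_le)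
          qed
          finally show ?case unfolding norm by simp
        qed
        show False using liminf_neq_0[OF _ bd] \<delta>(1) liminf by simp
      next
        \<comment> \<open>For \<open>f = 0\<close> the orbit is zero, which contradicts the infinite
          upper limit instead.\<close>
        case False
        then have bd: "pw_norm (f \<circ> (?\<phi> ^^ n)) \<le> 0" for n
          by (simp add: pw_norm_eq)
        show False using limsup_neq_PInf[OF bd] limsup by simp
      qed
    qed
  qed
  then show ?thesis
    unfolding li_yorke_chaotic_def composition_operator_funpow
    by blast
qed

end
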